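(* Let $N_2(n)$ denote the number of pairwise non-isomorphic strong bicentral $2$-trees on $n$ vertices with tail set $\{2,3\}$ (over all possible maximum degrees). Then $N_2(n)\ge n-5$ for all $n\ge 7$.
   Context: A $2$-tree is a graph obtained from the triangle $K_3$ by repeatedly adding a new vertex adjacent to both endpoints of an existing edge. For $r\in\{1,2,3\}$ and an integer $\Delta\ge 2$, a $2$-tree on $n$ vertices is $r$-central with maximum degree $\Delta$ if $\Delta$ is its maximum degree and exactly $r$ vertices have degree $\Delta$; these $r$ vertices form the core and the other $n-r$ vertices form the tail. It is strong if the core induces $K_r$. It has tail set $\{2,3\}$ if every tail vertex has degree $2$ or $3$. "Bicentral" means $2$-central. *)

theory Defs
  imports Main
begin

text \<open>A simple graph is a pair of a vertex set and a set of two-element subsets of it.\<close>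

type_synonym 'a sgraph = "'a set \<times> 'a set set"

abbreviation verts :: "'a sgraph \<Rightarrow> 'a set" where
  "verts G \<equiv> fst G"

abbreviation edges :: "'a sgraph \<Rightarrow> 'a set set" where
  "edges G \<equiv> snd G"

definition degree :: "'a sgraph \<Rightarrow> 'a \<Rightarrow> nat" where
  "degree G v = card {e \<in> edges G. v \<in> e}"

definition max_degree :: "'a sgraph \<Rightarrow> nat" where
  "max_degree G = Max (degree G ` verts G)"

definition iso :: "'a sgraph \<Rightarrow> 'b sgraph \<Rightarrow> bool" where
  "iso G H \<longleftrightarrow>
     (\<exists>f. bij_betw f (verts G) (verts H) \<and>
          (\<forall>u\<in>verts G. \<forall>v\<in>verts G. {u, v} \<in> edges G \<longleftrightarrow> {f u, f v} \<in> edges H))"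

inductive two_tree :: "'a sgraph \<Rightarrow> bool" where
  triangle: "a \<noteq> b \<Longrightarrow> b \<noteq> c \<Longrightarrow> a \<noteq> c \<Longrightarrow> two_tree ({a, b, c}, {{a, b}, {b, c}, {a, c}})"
| extend: "two_tree (V, E) \<Longrightarrow> {u, v} \<in> E \<Longrightarrow> w \<notin> V \<Longrightarrow>
             two_tree (insert w V, E \<union> {{w, u}, {w, v}})"

definition core :: "nat \<Rightarrow> 'a sgraph \<Rightarrow> 'a set" where
  "core \<Delta> G = {v \<in> verts G. degree G v = \<Delta>}"

definition tail :: "nat \<Rightarrow> 'a sgraph \<Rightarrow> 'a set" where
  "tail \<Delta> G = verts G - core \<Delta> G"

definition central :: "nat \<Rightarrow> nat \<Rightarrow> 'a sgraph \<Rightarrow> bool" where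
  "central r \<Delta> G \<longleftrightarrow>
     r \<in> {1, 2, 3} \<and> \<Delta> \<ge> 2 \<and> two_tree G \<and> max_degree G = \<Delta> \<and> card (core \<Delta> G) = r"

text \<open>The core induces a complete graph; in an \<open>r\<close>-central graph this is \<open>K\<^sub>r\<close>.\<close>

definition strong :: "nat \<Rightarrow> 'a sgraph \<Rightarrow> bool" where
  "strong \<Delta> G \<longleftrightarrow> (\<forall>u\<in>core \<Delta> G. \<forall>v\<in>core \<Delta> G. u \<noteq> v \<longrightarrow> {u, v} \<in> edges G)"

text \<open>Degrees of tail vertices must lie in \<open>S\<close>; not every element of \<open>S\<close> has to occur.\<close>

definition has_tail_set :: "nat set \<Rightarrow> nat \<Rightarrow> 'a sgraph \<Rightarrow> bool" where
  "has_tail_set S \<Delta> G \<longleftrightarrow> (\<forall>v\<in>tail \<Delta> G. degree G v \<in> S)"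

text \<open>
  Every graph on \<open>n\<close> vertices has an isomorphic copy with vertex set \<open>{..<n}\<close>, so
  isomorphism classes are counted among the graphs on that vertex set.
\<close>

definition strong_bicentral_23 :: "nat \<Rightarrow> nat sgraph set" where
  "strong_bicentral_23 n =
     {G. verts G = {..<n} \<and> (\<exists>\<Delta>. central 2 \<Delta> G \<and> strong \<Delta> G \<and> has_tail_set {2, 3} \<Delta> G)}"

definition N2 :: "nat \<Rightarrow> nat" where
  "N2 n = card (strong_bicentral_23 n //
     {(G, H). G \<in> strong_bicentral_23 n \<and> H \<in> strong_bicentral_23 n \<and> iso G H})"

end

theory Submission
  imports Defs
begin

text \<open>
  Join two hubs \<open>0\<close> and \<open>1\<close> by an edge and glue fans to it: a fan of length \<open>k\<close> at a hub is a path
  on \<open>k\<close> vertices joined to that hub, its first vertex being joined to the other hub as well.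
  Every inner vertex then has degree \<open>2\<close> or \<open>3\<close>, and a fan of length \<open>k\<close> has \<open>k - 1\<close> vertices of
  degree \<open>3\<close>. Take one fan of length \<open>s + 1\<close> at hub \<open>0\<close>, fans of lengths \<open>s + 1 - t\<close> and
  \<open>t + 1\<close> at hub \<open>1\<close> with \<open>t \<in> {0, 1}\<close>, and fans of length \<open>1\<close> for the remaining vertices; both hubs
  have degree \<open>n - s - 1\<close>. The number \<open>2 * s\<close> of vertices of degree \<open>3\<close> recovers \<open>s\<close>, and for
  \<open>s \<ge> 2\<close> we have \<open>t = 1\<close> exactly if some vertex of degree \<open>3\<close> has no neighbour of degree \<open>3\<close>.
  The case \<open>t = 0\<close> needs \<open>2 * s + 4 \<le> n\<close> and the case \<open>t = 1\<close> needs \<open>s \<ge> 2\<close> and \<open>2 * s + 5 \<le> n\<close>,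
  which leaves \<open>n - 5\<close> pairs \<open>(s, t)\<close>.
\<close>

subsection \<open>Neighbourhoods and isomorphisms\<close>

definition neighbours :: "'a sgraph \<Rightarrow> 'a \<Rightarrow> 'a set" where
  "neighbours G v = {x \<in> verts G. {v, x} \<in> edges G}"

lemma two_tree_edge:
  assumes "two_tree G" "e \<in> edges G"
  shows "\<exists>x y. x \<noteq> y \<and> x \<in> verts G \<and> y \<in> verts G \<and> e = {x, y}"
  using assms
proof (induction arbitrary: e)
  case (triangle a b c)
  then show ?case by auto
next
  case (extend V E u v w)
  from extend.IH[of "{u, v}"] extend.hyps have "u \<in> V" "v \<in> V"
    by (auto simp: doubleton_eq_iff)
  then have new: "w \<noteq> u" "w \<noteq> v" "u \<in> V" "v \<in> V"
    using extend.hyps by auto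
  from extend.prems consider "e \<in> E" | "e = {w, u}" | "e = {w, v}" by auto
  then show ?case
  proof cases
    case 1
    then show ?thesis using extend.IH[of e] by auto
  qed (use new in auto)
qed

text \<open>Edges at \<open>v\<close> correspond to neighbours through
  \<open>x \<mapsto> {v, x}\<close>, so a bijection of vertices can transport degrees.\<close>

lemma degree_eq_card_neighbours:
  assumes "two_tree G"
  shows "degree G v = card (neighbours G v)"
proof -
  have "bij_betw (\<lambda>x. {v, x}) (neighbours G v) {e \<in> edges G. v \<in> e}"
    unfolding bij_betw_def
  proof
    show "inj_on (\<lambda>x. {v, x}) (neighbours G v)"
      by (auto simp: inj_on_def doubleton_eq_iff)
    show "(\<lambda>x. {v, x}) ` neighbours G v = {e \<in> edges G. v \<in> e}"
    proof (intro equalityI subsetI)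
      fix e assume "e \<in> {e \<in> edges G. v \<in> e}"
      moreover from this obtain x y where "x \<in> verts G" "y \<in> verts G" "e = {x, y}"
        using two_tree_edge[OF assms] by blast
      ultimately show "e \<in> (\<lambda>x. {v, x}) ` neighbours G v"
        by (auto simp: neighbours_def insert_commute image_iff)
    qed (auto simp: neighbours_def)
  qed
  then show ?thesis
    unfolding degree_def by (simp add: bij_betw_same_card)
qed

lemma iso_refl: "iso G G"
  unfolding iso_def by (rule exI[of _ id]) auto

lemma iso_degreeE:
  assumes "iso G H" "two_tree G" "two_tree H"
  obtains f where "bij_betw f (verts G) (verts H)"
    "\<And>v. v \<in> verts G \<Longrightarrow> neighbours H (f v) = f ` neighbours G v"
    "\<And>v. v \<in> verts G \<Longrightarrow> degree H (f v) = degree G v"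
proof -
  from assms(1) obtain f where bij: "bij_betw f (verts G) (verts H)"
    and adj: "\<And>u v. u \<in> verts G \<Longrightarrow> v \<in> verts G \<Longrightarrow>
      {u, v} \<in> edges G \<longleftrightarrow> {f u, f v} \<in> edges H"
    unfolding iso_def by blast
  have nb: "neighbours H (f v) = f ` neighbours G v" if "v \<in> verts G" for v
    using adj[OF that] unfolding neighbours_def bij_betw_imp_surj_on[OF bij, symmetric] by auto
  have "degree H (f v) = degree G v" if "v \<in> verts G" for v
  proof -
    have "inj_on f (neighbours G v)"
      by (rule inj_on_subset[OF bij_betw_imp_inj_on[OF bij]]) (auto simp: neighbours_def)
    then show ?thesis
      using nb[OF that] assms by (simp add: degree_eq_card_neighbours card_image)
  qed
  with bij nb that show thesis by blast
qed

lemma iso_card_degree: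
  assumes "iso G H" "two_tree G" "two_tree H"
  shows "card {v \<in> verts G. degree G v = d} = card {v \<in> verts H. degree H v = d}"
proof -
  from assms obtain f where f: "bij_betw f (verts G) (verts H)"
    "\<And>v. v \<in> verts G \<Longrightarrow> degree H (f v) = degree G v"
    by (rule iso_degreeE) blast
  have "f ` {v \<in> verts G. degree G v = d} = {v \<in> verts H. degree H v = d}"
    unfolding bij_betw_imp_surj_on[OF f(1), symmetric] using f(2) by auto
  then have "bij_betw f {v \<in> verts G. degree G v = d} {v \<in> verts H. degree H v = d}"
    by (intro bij_betw_subset[OF f(1)]) auto
  then show ?thesis by (rule bij_betw_same_card)
qed

text \<open>With \<open>d = 3\<close> this isomorphism invariant tells \<open>t = 0\<close> from
  \<open>t = 1\<close> once \<open>2 \<le> s\<close>.\<close>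

definition has_isolated_degree :: "nat \<Rightarrow> 'a sgraph \<Rightarrow> bool" where
  "has_isolated_degree d G \<longleftrightarrow>
     (\<exists>v\<in>verts G. degree G v = d \<and> (\<forall>x\<in>neighbours G v. degree G x \<noteq> d))"

lemma iso_has_isolated_degree:
  assumes "iso G H" "two_tree G" "two_tree H"
  shows "has_isolated_degree d G \<longleftrightarrow> has_isolated_degree d H"
proof -
  from assms obtain f where f: "bij_betw f (verts G) (verts H)"
    "\<And>v. v \<in> verts G \<Longrightarrow> neighbours H (f v) = f ` neighbours G v"
    "\<And>v. v \<in> verts G \<Longrightarrow> degree H (f v) = degree G v"
    by (rule iso_degreeE) blast
  have "verts H = f ` verts G"
    using f(1) by (simp add: bij_betw_def)
  moreover have "\<And>v x. x \<in> neighbours G v \<Longrightarrow> x \<in> verts G"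
    by (simp add: neighbours_def)
  ultimately show ?thesis
    unfolding has_isolated_degree_def by (simp add: f(2,3))
qed

subsection \<open>Gluing fans to an edge\<close>

text \<open>Encodes a construction sequence: \<open>w\<close> is glued to the edge joining
  \<open>a w\<close> and \<open>b w\<close>, so raising \<open>n\<close> by one is a single
  \<open>extend\<close> step.\<close>

definition attach_edges :: "(nat \<Rightarrow> nat) \<Rightarrow> (nat \<Rightarrow> nat) \<Rightarrow> nat \<Rightarrow> nat set set" where
  "attach_edges a b n = insert {0, 1} (\<Union>w\<in>{2..<n}. {{w, a w}, {w, b w}})"

lemma two_tree_attach_edges:
  assumes "a 2 = 0" "b 2 = 1"
    and "\<And>w. 2 < w \<Longrightarrow> {a w, b w} \<in> attach_edges a b w"
    and "3 \<le> n"
  shows "two_tree ({..<n}, attach_edges a b n)"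
  using \<open>3 \<le> n\<close>
proof (induction n rule: dec_induct)
  case base
  have "{..<3::nat} = {0, 1, 2}" "{2..<3::nat} = {2}" by auto
  then show ?case
    using two_tree.triangle[of "0::nat" 1 2] assms(1,2)
    by (simp add: attach_edges_def insert_commute)
next
  case (step n)
  have "attach_edges a b (Suc n) = attach_edges a b n \<union> {{n, a n}, {n, b n}}"
    using step.hyps by (auto simp: attach_edges_def atLeastLessThanSuc)
  with two_tree.extend[OF step.IH assms(3)[of n], of n] step.hyps show ?case
    by (simp add: lessThan_Suc)
qed

text \<open>
  The vertices of each fan are numbered consecutively: a vertex either starts a new fan or
  follows its predecessor.
\<close>

definition fan_start :: "nat \<Rightarrow> nat \<Rightarrow> nat \<Rightarrow> bool" where
  "fan_start s t w \<longleftrightarrow> w = 2 \<or> w = s + 3 \<or> w + t = 2 * s + 4 \<or> 2 * s + 5 \<le> w"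

text \<open>The fan \<open>2..s + 2\<close> sits at hub \<open>0\<close>. At hub \<open>1\<close>
  sit \<open>s + 3..2 * s + 3 - t\<close>, then \<open>2 * s + 4 - t..2 * s + 4\<close>, then single
  vertices.\<close>

definition hub :: "nat \<Rightarrow> nat \<Rightarrow> nat" where
  "hub s w = (if w \<le> s + 2 then 0 else 1)"

definition second :: "nat \<Rightarrow> nat \<Rightarrow> nat \<Rightarrow> nat" where
  "second s t w = (if fan_start s t w then 1 - hub s w else w - 1)"

lemma hub_le_1: "hub s w \<le> 1"
  by (simp add: hub_def)

lemma hub_eq_0_iff: "hub s w = 0 \<longleftrightarrow> w \<le> s + 2"
  by (simp add: hub_def)

lemma hub_eq_1_iff: "hub s w = 1 \<longleftrightarrow> s + 2 < w"
  by (simp add: hub_def)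

lemma second_eq_0_iff: "2 \<le> w \<Longrightarrow> second s t w = 0 \<longleftrightarrow> fan_start s t w \<and> s + 2 < w"
  by (auto simp: second_def hub_def)

lemma second_eq_1_iff: "2 \<le> w \<Longrightarrow> second s t w = 1 \<longleftrightarrow> fan_start s t w \<and> w \<le> s + 2"
  by (auto simp: second_def hub_def fan_start_def)

lemma second_eq_ge2_iff: "2 \<le> x \<Longrightarrow> second s t w = x \<longleftrightarrow> \<not> fan_start s t w \<and> w = x + 1"
  by (auto simp: second_def hub_def)

definition fan_graph :: "nat \<Rightarrow> nat \<Rightarrow> nat \<Rightarrow> nat sgraph" where
  "fan_graph n s t = ({..<n}, attach_edges (hub s) (second s t) n)"

lemma verts_fan_graph [simp]: "verts (fan_graph n s t) = {..<n}"
  by (simp add: fan_graph_def)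

text \<open>The first vertex of a fan is glued to the edge between the hubs, any other to the edge
  between its predecessor and their common hub.\<close>

lemma two_tree_fan_graph:
  assumes "3 \<le> n"
  shows "two_tree (fan_graph n s t)"
  unfolding fan_graph_def
proof (rule two_tree_attach_edges)
  fix w :: nat assume w: "2 < w"
  show "{hub s w, second s t w} \<in> attach_edges (hub s) (second s t) w"
  proof (cases "fan_start s t w")
    case True
    then have "{hub s w, second s t w} = {0, 1}"
      by (auto simp: second_def hub_def)
    then show ?thesis
      by (simp add: attach_edges_def)
  next
    case False
    \<comment> \<open>The hub changes only at \<open>s + 3\<close>, where a fan starts.\<close>
    then have "hub s w = hub s (w - 1)"
      by (auto simp: fan_start_def hub_def)
    moreover have "w - 1 \<in> {2..<w}"
      using False w by auto
    ultimately have "{w - 1, hub s w} \<in> attach_edges (hub s) (second s t) w"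
      unfolding attach_edges_def by auto
    with False show ?thesis
      by (simp add: second_def insert_commute)
  qed
qed (use assms in \<open>simp_all add: hub_def second_def fan_start_def\<close>)

section \<open>Neighbourhoods and degrees in the fan graphs\<close>

locale fan_params =
  fixes n s t :: nat
  assumes n_ge: "7 \<le> n"
    and params: "t = 0 \<and> 2 * s + 4 \<le> n \<or> t = 1 \<and> 2 \<le> s \<and> 2 * s + 5 \<le> n"
begin

abbreviation G :: "nat sgraph" where
  "G \<equiv> fan_graph n s t"

lemma two_tree_G: "two_tree G"
  using n_ge by (simp add: two_tree_fan_graph)

lemma adj_iff:
  "{x, y} \<in> edges G \<longleftrightarrow> {x, y} = {0, 1}
     \<or> 2 \<le> x \<and> x < n \<and> (y = hub s x \<or> y = second s t x)
     \<or> 2 \<le> y \<and> y < n \<and> (x = hub s y \<or> x = second s t y)"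
  by (auto simp: fan_graph_def attach_edges_def doubleton_eq_iff)

text \<open>Hub \<open>0\<close> meets its whole fan but only the first vertices of the fans at hub
  \<open>1\<close>; the earliest of these, \<open>s + 3\<close>, extends the interval.\<close>

lemma neighbours_0: "neighbours G 0 = {1..s + 3} \<union> {w. fan_start s t w \<and> s + 3 < w \<and> w < n}"
proof -
  have "{0, x} \<in> edges G \<longleftrightarrow> x = 1 \<or> 2 \<le> x \<and> x < n \<and> (x \<le> s + 2 \<or> fan_start s t x)" for x
    using hub_eq_0_iff[of s x] second_eq_0_iff[of x s t]
    by (auto simp: adj_iff doubleton_eq_iff)
  then have "x \<in> neighbours G 0 \<longleftrightarrow>
      x = 1 \<or> 2 \<le> x \<and> x < n \<and> (x \<le> s + 2 \<or> fan_start s t x)" for x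
    using n_ge by (auto simp: neighbours_def)
  moreover have "x = 1 \<or> 2 \<le> x \<and> x < n \<and> (x \<le> s + 2 \<or> fan_start s t x) \<longleftrightarrow>
      x \<in> {1..s + 3} \<union> {w. fan_start s t w \<and> s + 3 < w \<and> w < n}" for x
  proof -
    have "fan_start s t x" if "x = s + 3"
      using that by (simp add: fan_start_def)
    moreover have "s + 3 < n"
      using params n_ge by auto
    moreover have "x \<le> s + 2 \<or> x = s + 3 \<or> s + 3 < x" "x = 0 \<or> x = 1 \<or> 2 \<le> x"
      by auto
    ultimately show ?thesis by auto
  qed
  ultimately show ?thesis by blast
qed

lemma neighbours_1: "neighbours G 1 = {0, 2} \<union> {s + 3..<n}"
proof -
  have "{1, x} \<in> edges G \<longleftrightarrow> x = 0 \<or> 2 \<le> x \<and> x < n \<and> (s + 2 < x \<or> x = 2)" for x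
    using hub_eq_1_iff[of s x] second_eq_1_iff[of x s t] params
    by (auto simp: adj_iff doubleton_eq_iff fan_start_def)
  then have "x \<in> neighbours G 1 \<longleftrightarrow> x = 0 \<or> 2 \<le> x \<and> x < n \<and> (s + 2 < x \<or> x = 2)" for x
    unfolding neighbours_def using n_ge by simp linarith
  moreover have "x = 0 \<or> 2 \<le> x \<and> x < n \<and> (s + 2 < x \<or> x = 2) \<longleftrightarrow> x \<in> {0, 2} \<union> {s + 3..<n}" for x
    using n_ge by (simp, linarith)
  ultimately show ?thesis by blast
qed

lemma neighbours_ge2:
  assumes "2 \<le> w" "w < n"
  shows "neighbours G w =
    {hub s w, second s t w} \<union> (if w + 1 < n \<and> \<not> fan_start s t (w + 1) then {w + 1} else {})"
proof -
  have "{w, x} \<in> edges G \<longleftrightarrow> x = hub s w \<or> x = second s t w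
      \<or> x = w + 1 \<and> x < n \<and> \<not> fan_start s t x" for x
    using assms second_eq_ge2_iff[of w s t x] hub_le_1[of s x]
    by (auto simp: adj_iff doubleton_eq_iff)
  moreover have "hub s w < n" "second s t w < n"
    using assms hub_le_1[of s w] by (auto simp: second_def)
  ultimately show ?thesis
    by (auto simp: neighbours_def)
qed

lemma degree_0: "degree G 0 = n - s - 1"
proof -
  \<comment> \<open>Passing from \<open>t = 0\<close> to \<open>t = 1\<close> replaces the fan start
    \<open>2 * s + 4\<close> by \<open>2 * s + 3\<close>, so the count does not depend on
    \<open>t\<close>.\<close>
  have "neighbours G 0 =
    {1..s + 3} \<union> ((if t = 1 then {2 * s + 3} else {}) \<union> {2 * s + 4 + t..<n})"
    unfolding neighbours_0 using n_ge params by (auto simp: fan_start_def)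
  also have "card \<dots> = s + 3 + card ((if t = 1 then {2 * s + 3} else {}) \<union> {2 * s + 4 + t..<n})"
    using params by (subst card_Un_disjoint) auto
  also have "\<dots> = n - s - 1"
    using params by auto
  finally show ?thesis
    by (simp add: degree_eq_card_neighbours[OF two_tree_G])
qed

lemma degree_1: "degree G 1 = n - s - 1"
proof -
  have "card ({0, 2} \<union> {s + 3..<n}) = 2 + (n - (s + 3))"
    by (subst card_Un_disjoint) auto
  then show ?thesis
    using n_ge params by (auto simp: degree_eq_card_neighbours[OF two_tree_G] neighbours_1[simplified])
qed

text \<open>Both vertices to which \<open>w\<close> is glued precede it, so a successor in the same
  fan is a third neighbour.\<close>

lemma degree_ge2:
  assumes "2 \<le> w" "w < n"
  shows "degree G w = (if w + 1 < n \<and> \<not> fan_start s t (w + 1) then 3 else 2)"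
proof -
  have "hub s w < w" "second s t w < w" "hub s w \<noteq> second s t w"
    using assms by (auto simp: hub_def second_def fan_start_def)
  then show ?thesis
    by (simp add: degree_eq_card_neighbours[OF two_tree_G] neighbours_ge2[OF assms])
qed

text \<open>Keeps the hubs apart from the tail: they alone form the core, and neither counts as a
  vertex of degree \<open>3\<close>.\<close>

lemma hub_degree_gt: "3 < n - s - 1"
  using n_ge params by auto

lemma degree_cases:
  assumes "w < n"
  shows "w < 2 \<and> degree G w = n - s - 1 \<or> 2 \<le> w \<and> degree G w \<in> {2, 3}"
proof -
  consider "w = 0" | "w = 1" | "2 \<le> w" by linarith
  then show ?thesis
    using assms by cases (simp_all add: degree_0 degree_1[simplified] degree_ge2)
qed

section \<open>Membership in the counted class\<close>

lemma core_G: "core (n - s - 1) G = {0, 1}"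
proof -
  have "w \<in> core (n - s - 1) G \<longleftrightarrow> w < 2" for w
    using degree_cases[of w] hub_degree_gt n_ge by (auto simp: core_def)
  moreover have "w < 2 \<longleftrightarrow> w \<in> {0, 1}" for w :: nat by auto
  ultimately show ?thesis by blast
qed

lemma max_degree_G: "max_degree G = n - s - 1"
  unfolding max_degree_def
proof (rule Max_eqI)
  show "n - s - 1 \<in> degree G ` verts G"
    using n_ge degree_0 by (auto intro!: image_eqI[of _ _ 0])
  fix d assume "d \<in> degree G ` verts G"
  then show "d \<le> n - s - 1"
    using degree_cases hub_degree_gt by fastforce
qed simp

lemma G_mem: "G \<in> strong_bicentral_23 n"
  unfolding strong_bicentral_23_def
proof (intro CollectI conjI exI)
  show "central 2 (n - s - 1) G"
    using hub_degree_gt by (simp add: central_def two_tree_G max_degree_G core_G[simplified])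
  show "strong (n - s - 1) G"
    unfolding strong_def core_G using adj_iff by (simp add: insert_commute)
  show "has_tail_set {2, 3} (n - s - 1) G"
    using degree_cases by (auto simp: has_tail_set_def tail_def core_def)
qed simp

section \<open>Invariants recovering \<open>s\<close> and \<open>t\<close>\<close>

lemma degree_3_iff:
  "w < n \<and> degree G w = 3 \<longleftrightarrow> w \<in> {2..s + 1} \<union> ({s + 3..2 * s + 2 + t} - (if t = 1 then {2 * s + 2} else {}))"
proof (cases "2 \<le> w \<and> w < n")
  case True
  then show ?thesis
    \<comment> \<open>Degree \<open>3\<close> means not being last in a fan; for
      \<open>t = 1\<close> the vertex \<open>2 * s + 2\<close> is removed because it ends the fan of
      length \<open>s\<close>.\<close>
    using n_ge params by (auto simp: degree_ge2 fan_start_def split: if_splits)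
next
  case False
  then show ?thesis
    using degree_cases[of w] hub_degree_gt params by auto
qed

lemma card_degree_3: "card {w \<in> verts G. degree G w = 3} = 2 * s"
proof -
  let ?B = "{s + 3..2 * s + 2 + t} - (if t = 1 then {2 * s + 2} else {})"
  have "{w \<in> verts G. degree G w = 3} = {2..s + 1} \<union> ?B"
    unfolding verts_fan_graph lessThan_iff degree_3_iff by (rule Collect_mem_eq)
  also have "card \<dots> = card {2..s + 1} + card ?B"
    by (rule card_Un_disjoint) auto
  also have "\<dots> = 2 * s"
    using params by auto
  finally show ?thesis .
qed

text \<open>For \<open>t = 1\<close> the fan of length \<open>2\<close> has a lone vertex of degree
  \<open>3\<close>. For \<open>t = 0\<close> these vertices form two paths of \<open>s\<close>
  vertices, and \<open>2 \<le> s\<close> gives each a neighbour on its path.\<close>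

lemma has_isolated_degree_3_iff:
  assumes "2 \<le> s"
  shows "has_isolated_degree 3 G \<longleftrightarrow> t = 1"
proof
  assume t: "t = 1"
  let ?w = "2 * s + 3"
  have w: "?w < n" "degree G ?w = 3"
    using degree_3_iff[of ?w] t params by auto
  have "degree G x \<noteq> 3" if "x \<in> neighbours G ?w" for x
  proof -
    have "x \<in> {0, 1, 2 * s + 4}"
      using that w(1) t neighbours_ge2[of ?w]
      by (auto simp: hub_def second_def fan_start_def split: if_splits)
    then show ?thesis
      using degree_3_iff[of x] t params by auto
  qed
  with w show "has_isolated_degree 3 G"
    by (auto simp: has_isolated_degree_def)
next
  assume iso3: "has_isolated_degree 3 G"
  show "t = 1"
  proof (rule ccontr)
    assume "t \<noteq> 1"
    with params have t: "t = 0" by auto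
    from iso3 obtain w where w: "w < n" "degree G w = 3"
      and nb: "\<And>x. x \<in> neighbours G w \<Longrightarrow> degree G x \<noteq> 3"
      by (auto simp: has_isolated_degree_def)
    have range: "w \<in> {2..s + 1} \<union> {s + 3..2 * s + 2}"
      using degree_3_iff[of w] w t by auto
    \<comment> \<open>The neighbour on the same path: the successor for the first vertex, the
      predecessor otherwise.\<close>
    define x where "x = (if w = 2 \<or> w = s + 3 then w + 1 else w - 1)"
    have "x \<in> neighbours G w"
    proof (cases "w = 2 \<or> w = s + 3")
      case True
      have "2 \<le> w" using range by auto
      with w have "w + 1 < n \<and> \<not> fan_start s t (w + 1)"
        using degree_ge2[of w] by (auto split: if_splits)
      with True \<open>2 \<le> w\<close> w show ?thesis
        using neighbours_ge2[of w] by (simp add: x_def)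
    next
      case False
      with range t have "2 \<le> w" "second s t w = x"
        by (auto simp: second_def fan_start_def x_def)
      with w show ?thesis
        using neighbours_ge2[of w] by simp
    qed
    moreover have "degree G x = 3"
      using degree_3_iff[of x] range assms t by (auto simp: x_def)
    ultimately show False
      using nb by blast
  qed
qed

end

lemma fan_graph_iso_imp_eq:
  assumes "fan_params n s t" "fan_params n s' t'" "iso (fan_graph n s t) (fan_graph n s' t')"
  shows "s = s' \<and> t = t'"
proof -
  interpret A: fan_params n s t by fact
  interpret B: fan_params n s' t' by fact
  note trees = assms(3) A.two_tree_G B.two_tree_G
  have s: "s = s'"
    using iso_card_degree[OF trees, of 3] A.card_degree_3 B.card_degree_3 by simp
  have "t = 1 \<longleftrightarrow> t' = 1" if "2 \<le> s"
    using iso_has_isolated_degree[OF trees, of 3] A.has_isolated_degree_3_iff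
      B.has_isolated_degree_3_iff that s by simp
  \<comment> \<open>For \<open>s < 2\<close> the parameter condition forces \<open>t = 0\<close> and
    \<open>t' = 0\<close>.\<close>
  with s show ?thesis
    using A.params B.params by auto
qed

subsection \<open>Counting isomorphism classes\<close>

text \<open>Without finiteness \<open>card\<close> could default to \<open>0\<close> in
  \<open>N2\<close>.\<close>

lemma finite_strong_bicentral_23: "finite (strong_bicentral_23 n)"
proof (rule finite_subset)
  show "strong_bicentral_23 n \<subseteq> {{..<n}} \<times> Pow (Pow {..<n})"
  proof
    fix G assume "G \<in> strong_bicentral_23 n"
    then have "verts G = {..<n}" "two_tree G"
      by (auto simp: strong_bicentral_23_def central_def)
    then show "G \<in> {{..<n}} \<times> Pow (Pow {..<n})"
      using two_tree_edge[of G] by (cases G) fastforce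
  qed
qed simp

text \<open>If \<open>g i\<close> and \<open>g j\<close> have equal classes, reflexivity at
  \<open>g j\<close> puts \<open>g j\<close> into the class of \<open>g i\<close>, hence
  \<open>i = j\<close>.\<close>

lemma card_le_card_quotient:
  assumes "finite A" "r \<subseteq> A \<times> A"
    and "\<And>i. i \<in> I \<Longrightarrow> g i \<in> A \<and> (g i, g i) \<in> r"
    and "\<And>i j. i \<in> I \<Longrightarrow> j \<in> I \<Longrightarrow> (g i, g j) \<in> r \<Longrightarrow> i = j"
  shows "card I \<le> card (A // r)"
proof (rule card_inj_on_le)
  show "inj_on (\<lambda>i. r `` {g i}) I"
    using assms(3,4) by (fastforce intro!: inj_onI)
  show "(\<lambda>i. r `` {g i}) ` I \<subseteq> A // r"
    using assms(3) by (auto intro: quotientI)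
  show "finite (A // r)"
    using assms(1,2) by (rule finite_quotient)
qed

theorem theorem4p13:
  fixes n :: nat
  assumes "n \<ge> 7"
  shows "N2 n \<ge> n - 5"
proof -
  \<comment> \<open>The sizes are \<open>(n - 4) div 2 + 1\<close> and
    \<open>(n - 5) div 2 - 1\<close>; the halves of consecutive numbers add up to
    \<open>n - 5\<close>.\<close>
  let ?I0 = "{..(n - 4) div 2} \<times> {0::nat}" and ?I1 = "{2..(n - 5) div 2} \<times> {1::nat}"
  have params: "fan_params n (fst i) (snd i)" if "i \<in> ?I0 \<union> ?I1" for i
    using that assms by unfold_locales auto
  have "n - 5 = card ?I0 + card ?I1"
    using assms by (simp add: card_cartesian_product)
  also have "\<dots> = card (?I0 \<union> ?I1)"
    by (rule card_Un_disjoint[symmetric]) auto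
  also have "\<dots> \<le> N2 n"
    unfolding N2_def
  proof (rule card_le_card_quotient[where g = "\<lambda>i. fan_graph n (fst i) (snd i)"])
    fix i assume "i \<in> ?I0 \<union> ?I1"
    then show "fan_graph n (fst i) (snd i) \<in> strong_bicentral_23 n \<and>
      (fan_graph n (fst i) (snd i), fan_graph n (fst i) (snd i)) \<in> {(G, H).
        G \<in> strong_bicentral_23 n \<and> H \<in> strong_bicentral_23 n \<and> iso G H}"
      using fan_params.G_mem[OF params] by (simp add: iso_refl)
  next
    fix i j assume "i \<in> ?I0 \<union> ?I1" "j \<in> ?I0 \<union> ?I1"
      "(fan_graph n (fst i) (snd i), fan_graph n (fst j) (snd j)) \<in> {(G, H).
        G \<in> strong_bicentral_23 n \<and> H \<in> strong_bicentral_23 n \<and> iso G H}"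
    then show "i = j"
      using fan_graph_iso_imp_eq[OF params params] by (simp add: prod_eq_iff)
  qed (auto simp: finite_strong_bicentral_23)
  finally show ?thesis .
qed

end
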